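(* Let $(D,G_o)$ be a two-sender unicast index-coding problem with a fully participated interaction between its sub-digraphs $D_1,D_2,D_3$. Suppose that $f(D)$ contains both arcs $(1,3)$ and $(3,1)$, and that either $f(D)$ has no arc going out of vertex $2$ or $f(D)$ has no arc going into vertex $2$. Suppose explicitly, then, that the arc set of $f(D)$ is $\{(1,3),(3,1)\}\cup B$ with $$B\in\bigl\{\emptyset,\ \{(2,3)\},\ \{(3,2)\},\ \{(1,2)\},\ \{(2,1)\},\ \{(1,2),(3,2)\},\ \{(2,1),(2,3)\}\bigr\}.$$ Then $\beta(D,G_o)=\beta(D)$.
   Context: There are $N$ messages $\mathcal{M}=\{x_1,\dots,x_N\}$, $x_i\in\{0,1\}^t$, and $N$ receivers; receiver $r$ requests $x_r$ and knows $\{x_j: j\in N_D^+(r)\}$, where $D$ is a loopless digraph on $V(D)=\{1,\dots,N\}$ (the side-information digraph) and $N_D^+(r)$ is the out-neighborhood of $r$. Single sender: an index code is an encoding function of all messages into $\{0,1\}^p$ together with decoding functions by which every receiver $r$ recovers $x_r$, for all message realizations, from the codeword and its side information. $\beta_t(D)$ is the minimum of $p/t$ over index codes for $t$-bit messages, and $\beta(D)=\inf_t\beta_t(D)=\lim_{t\to\infty}\beta_t(D)$. (The empty digraph has rate $0$.) Two senders: senders $S_1,S_2$ know $\mathcal{M}_1,\mathcal{M}_2$ with $\mathcal{M}_1\cup\mathcal{M}_2=\mathcal{M}$. A two-sender index code consists of encoding functions $\mathscr{F}_s:\{0,1\}^{|\mathcal{M}_s|t}\to\{0,1\}^{p_s}$,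 $s=1,2$ ($p_s\ge0$ an integer), and decoding functions by which every receiver $r$ recovers $x_r$, for all message realizations, from both sub-codewords and its side information. $\beta_t(D,G_o)$ is the minimum of $(p_1+p_2)/t$ over two-sender index codes for $t$-bit messages, and $\beta(D,G_o)=\inf_t\beta_t(D,G_o)=\lim_{t\to\infty}\beta_t(D,G_o)$. Here $G_o$ (the sender-constraint graph, with vertex set $V(D)$ and an edge $ij$ iff one of $x_i,x_j$ is in $\mathcal{M}_1\setminus\mathcal{M}_2$ and the other in $\mathcal{M}_2\setminus\mathcal{M}_1$) records the senders' message sets. Let $\mathcal{P}_1=\mathcal{M}_1\setminus\mathcal{M}_2$, $\mathcal{P}_2=\mathcal{M}_2\setminus\mathcal{M}_1$, $\mathcal{P}_3=\mathcal{M}_1\cap\mathcal{M}_2$. For $i\in\{1,2,3\}$, $D_i$ is the sub-digraph of $D$ induced by $\{j:x_j\in\mathcal{P}_i\}$. The digraph $f(D)$ has vertex set $\{1,2,3\}$, and $(i,j)$, $i\neq j$, is an arc of $f(D)$ iff there is an arc of $D$ from some vertex of $D_i$ to some vertex of $D_j$. The interaction is fully participated if, whenever $(i,j)$ is an arc of $f(D)$, every vertex of $D_i$ has arcs to all vertices of $D_j$. *)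

theory Defs
  imports "HOL-Analysis.Analysis" "Graph_Theory.Pair_Digraph" "Graph_Theory.Digraph_Component"
begin

definition bit_words :: "nat \<Rightarrow> bool list set" where
  "bit_words n = {w. length w = n}"

text \<open>
  Realizations of the \<open>t\<close>-bit messages indexed by \<open>M\<close>. A sender or receiver that knows only the
  messages in \<open>M\<close> is handed \<open>restrict x M\<close>, which is \<open>undefined\<close> off \<open>M\<close> and hence carries no
  information about the other messages.
\<close>

definition messages :: "'a set \<Rightarrow> nat \<Rightarrow> ('a \<Rightarrow> bool list) set" where
  "messages M t = M \<rightarrow>\<^sub>E bit_words t"

definition out_nbrs :: "'a pair_pre_digraph \<Rightarrow> 'a \<Rightarrow> 'a set" where
  "out_nbrs D r = {j. (r, j) \<in> parcs D}"

definition index_code ::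
  "'a pair_pre_digraph \<Rightarrow> nat \<Rightarrow> nat \<Rightarrow> (('a \<Rightarrow> bool list) \<Rightarrow> bool list)
   \<Rightarrow> ('a \<Rightarrow> bool list \<Rightarrow> ('a \<Rightarrow> bool list) \<Rightarrow> bool list) \<Rightarrow> bool" where
  "index_code D t p enc dec \<longleftrightarrow>
     enc \<in> messages (pverts D) t \<rightarrow> bit_words p \<and>
     (\<forall>r\<in>pverts D. \<forall>x\<in>messages (pverts D) t.
        dec r (enc x) (restrict x (out_nbrs D r)) = x r)"

text \<open>
  For finitely many messages the \<open>LEAST\<close> is attained, since sending all messages uncoded is an
  index code.
\<close>

definition beta_t :: "nat \<Rightarrow> 'a pair_pre_digraph \<Rightarrow> real" where
  "beta_t t D = real (LEAST p. \<exists>enc dec. index_code D t p enc dec) / real t"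

definition beta :: "'a pair_pre_digraph \<Rightarrow> real" where
  "beta D = (INF t\<in>{1..}. beta_t t D)"

text \<open>
  A two-sender problem is represented by the side-information digraph \<open>D\<close> and the index sets
  \<open>M1\<close>, \<open>M2\<close> of the messages known to the two senders (which is what the sender-constraint
  graph \<open>G\<^sub>o\<close> records), so \<open>\<beta>(D, G\<^sub>o)\<close> is written \<open>beta2 D M1 M2\<close>.
\<close>

definition two_sender_problem :: "'a pair_pre_digraph \<Rightarrow> 'a set \<Rightarrow> 'a set \<Rightarrow> bool" where
  "two_sender_problem D M1 M2 \<longleftrightarrow> pair_digraph D \<and> M1 \<union> M2 = pverts D"

definition two_sender_index_code ::
  "'a pair_pre_digraph \<Rightarrow> 'a set \<Rightarrow> 'a set \<Rightarrow> nat \<Rightarrow> nat \<Rightarrow> nat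
   \<Rightarrow> (('a \<Rightarrow> bool list) \<Rightarrow> bool list) \<Rightarrow> (('a \<Rightarrow> bool list) \<Rightarrow> bool list)
   \<Rightarrow> ('a \<Rightarrow> bool list \<Rightarrow> bool list \<Rightarrow> ('a \<Rightarrow> bool list) \<Rightarrow> bool list) \<Rightarrow> bool" where
  "two_sender_index_code D M1 M2 t p1 p2 enc1 enc2 dec \<longleftrightarrow>
     enc1 \<in> messages M1 t \<rightarrow> bit_words p1 \<and>
     enc2 \<in> messages M2 t \<rightarrow> bit_words p2 \<and>
     (\<forall>r\<in>pverts D. \<forall>x\<in>messages (pverts D) t.
        dec r (enc1 (restrict x M1)) (enc2 (restrict x M2)) (restrict x (out_nbrs D r)) = x r)"

definition beta2_t :: "nat \<Rightarrow> 'a pair_pre_digraph \<Rightarrow> 'a set \<Rightarrow> 'a set \<Rightarrow> real" where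
  "beta2_t t D M1 M2 =
     real (LEAST p. \<exists>p1 p2 enc1 enc2 dec.
             p = p1 + p2 \<and> two_sender_index_code D M1 M2 t p1 p2 enc1 enc2 dec) / real t"

definition beta2 :: "'a pair_pre_digraph \<Rightarrow> 'a set \<Rightarrow> 'a set \<Rightarrow> real" where
  "beta2 D M1 M2 = (INF t\<in>{1..}. beta2_t t D M1 M2)"

text \<open>Only the indices 1, 2, 3 are meaningful.\<close>

definition msg_part :: "'a set \<Rightarrow> 'a set \<Rightarrow> nat \<Rightarrow> 'a set" where
  "msg_part M1 M2 i = (if i = 1 then M1 - M2 else if i = 2 then M2 - M1 else M1 \<inter> M2)"

definition sub_digraph ::
  "'a pair_pre_digraph \<Rightarrow> 'a set \<Rightarrow> 'a set \<Rightarrow> nat \<Rightarrow> ('a, 'a \<times> 'a) pre_digraph" where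
  "sub_digraph D M1 M2 i = with_proj D \<restriction> msg_part M1 M2 i"

definition interaction_digraph ::
  "'a pair_pre_digraph \<Rightarrow> 'a set \<Rightarrow> 'a set \<Rightarrow> nat pair_pre_digraph" where
  "interaction_digraph D M1 M2 =
     \<lparr> pverts = {1, 2, 3},
       parcs = {(i, j). i \<in> {1, 2, 3} \<and> j \<in> {1, 2, 3} \<and> i \<noteq> j \<and>
                 (\<exists>u\<in>verts (sub_digraph D M1 M2 i). \<exists>v\<in>verts (sub_digraph D M1 M2 j).
                    (u, v) \<in> parcs D)} \<rparr>"

definition fully_participated :: "'a pair_pre_digraph \<Rightarrow> 'a set \<Rightarrow> 'a set \<Rightarrow> bool" where
  "fully_participated D M1 M2 \<longleftrightarrow>
     (\<forall>(i, j)\<in>parcs (interaction_digraph D M1 M2).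
        \<forall>u\<in>verts (sub_digraph D M1 M2 i). \<forall>v\<in>verts (sub_digraph D M1 M2 j).
          (u, v) \<in> parcs D)"

end

theory Submission
  imports Defs "HOL-Real_Asymp.Real_Asymp"
begin

text \<open>
  In every case there are no arcs from \<open>M1\<close> to \<open>M2 - M1\<close>, or no arcs in the other direction. Sender 1
  serves \<open>M1\<close> and sender 2 serves \<open>M2 - M1\<close>, so the rate of \<open>D\<close> has to be split between these two
  induced subproblems. The largest fibre of a single-sender code of \<open>p\<close> bits is an independent set
  of the confusion graph with density at least \<open>2\<^sup>-\<^sup>p\<close>. Since one side knows nothing of the other, its
  projection to that side and its fibres over this projection are independent, so the densities of
  suitable independent sets in the two confusion graphs multiply to at least \<open>2\<^sup>-\<^sup>p\<close>. Conversely, the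
  confusion graph is a Cayley graph, hence greedily covered by few translates of a \<open>k\<close>-fold power of
  an independent set of density \<open>\<delta>\<close>: this colours it with \<open>\<delta>\<^sup>-\<^sup>k\<close> colours up to a factor linear in \<open>k\<close>,
  which does not affect the rate as \<open>k\<close> tends to infinity.
\<close>

text \<open>\<open>S\<close> is an independent set of the confusion graph of the subproblem induced by \<open>A\<close>.\<close>

definition decodable :: "'a pair_pre_digraph \<Rightarrow> 'a set \<Rightarrow> ('a \<Rightarrow> bool list) set \<Rightarrow> bool" where
  "decodable D A S \<longleftrightarrow>
     (\<forall>x\<in>S. \<forall>y\<in>S. \<forall>r\<in>A. (\<forall>j\<in>out_nbrs D r \<inter> A. x j = y j) \<longrightarrow> x r = y r)"

lemma decodableD:
  "decodable D A S \<Longrightarrow> x \<in> S \<Longrightarrow> y \<in> S \<Longrightarrow> r \<in> A \<Longrightarrow>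
   (\<And>j. j \<in> out_nbrs D r \<Longrightarrow> j \<in> A \<Longrightarrow> x j = y j) \<Longrightarrow> x r = y r"
  unfolding decodable_def by blast

lemma decodable_subset: "decodable D A S \<Longrightarrow> T \<subseteq> S \<Longrightarrow> decodable D A T"
  unfolding decodable_def by blast

section \<open>Bit words and message realizations\<close>

lemma finite_bit_words [simp]: "finite (bit_words n)"
  and card_bit_words [simp]: "card (bit_words n) = 2 ^ n"
proof -
  have eq: "bit_words n = {w. set w \<subseteq> (UNIV :: bool set) \<and> length w = n}"
    by (simp add: bit_words_def)
  show "finite (bit_words n)"
    unfolding eq by (rule finite_lists_length_eq) simp
  show "card (bit_words n) = 2 ^ n"
    unfolding eq by (subst card_lists_length_eq) simp_all
qed

lemma finite_messages [simp]: "finite A \<Longrightarrow> finite (messages A t)"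
  unfolding messages_def by (intro finite_PiE) auto

lemma card_messages: "finite A \<Longrightarrow> card (messages A t) = 2 ^ (t * card A)"
  unfolding messages_def by (simp add: card_PiE power_mult)

lemma length_message: "x \<in> messages A t \<Longrightarrow> i \<in> A \<Longrightarrow> length (x i) = t"
  unfolding messages_def bit_words_def by auto

lemma restrict_messages: "x \<in> messages A t \<Longrightarrow> B \<subseteq> A \<Longrightarrow> restrict x B \<in> messages B t"
  unfolding messages_def by auto

lemma messages_eqI:
  "x \<in> messages A t \<Longrightarrow> y \<in> messages A t \<Longrightarrow> (\<And>i. i \<in> A \<Longrightarrow> x i = y i) \<Longrightarrow> x = y"
  unfolding messages_def by (rule PiE_ext)

section \<open>From codes to independent sets\<close>

text \<open>Pigeonhole principle by averaging: were all fibres smaller, their sizes would sum to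
  less than \<open>card X\<close>. The product form avoids division.\<close>

lemma obtain_large_fibre:
  assumes "finite X" "finite Y" "Y \<noteq> {}" "f \<in> X \<rightarrow> Y"
  obtains y where "y \<in> Y" "card X \<le> card {x \<in> X. f x = y} * card Y"
proof -
  have "\<exists>y\<in>Y. card X \<le> card {x \<in> X. f x = y} * card Y"
  proof (rule ccontr)
    assume "\<not> ?thesis"
    then have lt: "card {x \<in> X. f x = y} * card Y < card X" if "y \<in> Y" for y
      using that by auto
    have "card X = (\<Sum>y\<in>Y. card {x \<in> X. f x = y})"
      using sum.group[of X Y f "\<lambda>_. 1 :: nat"] assms by (simp add: image_subset_iff_funcset)
    then have "card X * card Y = (\<Sum>y\<in>Y. card {x \<in> X. f x = y} * card Y)"
      by (simp add: sum_distrib_right)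
    also have "\<dots> < (\<Sum>y\<in>Y. card X)"
      using assms lt by (intro sum_strict_mono) auto
    finally show False by (simp add: mult.commute)
  qed
  then show thesis using that by blast
qed

text \<open>A receiver decodes alike on equal codewords and equal side information, so every
  codeword fibre is independent; pigeonhole over the \<open>2 ^ p\<close> codewords gives a large
  one.\<close>

lemma index_code_decodable:
  assumes code: "index_code D t p enc dec" and fin: "finite (pverts D)"
  obtains S where "S \<subseteq> messages (pverts D) t" "decodable D (pverts D) S"
    "card (messages (pverts D) t) \<le> card S * 2 ^ p"
proof -
  let ?V = "pverts D"
  have enc: "enc \<in> messages ?V t \<rightarrow> bit_words p"
    and dec: "\<And>r x. r \<in> ?V \<Longrightarrow> x \<in> messages ?V t \<Longrightarrow> dec r (enc x) (restrict x (out_nbrs D r)) = x r"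
    using code unfolding index_code_def by auto
  have ne: "bit_words p \<noteq> {}"
    using card_bit_words[of p] by (metis card.empty power_not_zero zero_neq_numeral)
  obtain w where w: "card (messages ?V t) \<le> card {x \<in> messages ?V t. enc x = w} * card (bit_words p)"
    using obtain_large_fibre[OF finite_messages[OF fin] finite_bit_words ne enc] by blast
  have "decodable D ?V {x \<in> messages ?V t. enc x = w}"
    unfolding decodable_def
  proof (intro ballI impI)
    fix x y r
    assume x: "x \<in> {x \<in> messages ?V t. enc x = w}" and y: "y \<in> {x \<in> messages ?V t. enc x = w}"
      and r: "r \<in> ?V" and eq: "\<forall>j\<in>out_nbrs D r \<inter> ?V. x j = y j"
    have "restrict x (out_nbrs D r) = restrict y (out_nbrs D r)"
    proof
      fix j
      show "restrict x (out_nbrs D r) j = restrict y (out_nbrs D r) j"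
      \<comment> \<open>Out-neighbours outside \<open>pverts D\<close> carry no information, since
        realizations are \<open>undefined\<close> there.\<close>
      proof (cases "j \<in> ?V")
        case False
        then have "x j = undefined" "y j = undefined"
          using x y unfolding messages_def by auto
        then show ?thesis by (simp add: restrict_def)
      qed (use eq in \<open>auto simp: restrict_def\<close>)
    qed
    then show "x r = y r" using dec[OF r, of x] dec[OF r, of y] x y by auto
  qed
  then show thesis by (intro that) (use w in auto)
qed

text \<open>\<open>SC\<close> collects the \<open>C\<close>-parts of all of \<open>S\<close>, and
  \<open>SA\<close> the \<open>A\<close>-parts of a fibre of at least average size over one
  \<open>C\<close>-part. Receivers in \<open>C\<close> never look into \<open>A\<close>, and within
  the fibre the \<open>C\<close>-part of the side information is constant, so both sets are
  independent.\<close>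

lemma decodable_split:
  assumes S: "S \<subseteq> messages (A \<union> C) t" and dec: "decodable D (A \<union> C) S"
    and no_arc: "\<And>u v. u \<in> C \<Longrightarrow> v \<in> A \<Longrightarrow> (u, v) \<notin> parcs D"
    and fin: "finite A" "finite C"
  obtains SA SC where "SA \<subseteq> messages A t" "decodable D A SA" "SC \<subseteq> messages C t" "decodable D C SC"
    "card S \<le> card SA * card SC"
proof (cases "S = {}")
  case True
  show thesis by (rule that[of "{}" "{}"]) (auto simp: True decodable_def)
next
  case False
  define SC where "SC = (\<lambda>x. restrict x C) ` S"
  have finS: "finite S" using S fin finite_messages finite_subset by blast
  have SC_sub: "SC \<subseteq> messages C t"
    unfolding SC_def using S restrict_messages[of _ "A \<union> C" t C] by auto
  have SC_dec: "decodable D C SC"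
    unfolding decodable_def
  proof (intro ballI impI)
    fix x y r assume "x \<in> SC" "y \<in> SC" and r: "r \<in> C"
      and eq: "\<forall>j\<in>out_nbrs D r \<inter> C. x j = y j"
    then obtain x' y' where x': "x' \<in> S" "x = restrict x' C" and y': "y' \<in> S" "y = restrict y' C"
      unfolding SC_def by auto
    have "x' r = y' r"
    proof (rule decodableD[OF dec x'(1) y'(1)])
      fix j assume j: "j \<in> out_nbrs D r" "j \<in> A \<union> C"
      then have "j \<in> C" using no_arc r unfolding out_nbrs_def by blast
      then show "x' j = y' j" using eq j x' y' by auto
    qed (use r in simp)
    then show "x r = y r" using x' y' r by simp
  qed
  have "finite SC" "SC \<noteq> {}" "(\<lambda>x. restrict x C) \<in> S \<rightarrow> SC"
    unfolding SC_def using False finS by auto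
  then obtain z where "z \<in> SC" "card S \<le> card {x \<in> S. restrict x C = z} * card SC"
    by (rule obtain_large_fibre[OF finS])
  moreover define F where "F = {x \<in> S. restrict x C = z}"
  moreover define SA where "SA = (\<lambda>x. restrict x A) ` F"
  have F_eq: "x j = y j" if "x \<in> F" "y \<in> F" "j \<in> C" for x y j
  proof -
    have "restrict x C j = restrict y C j" using that(1,2) by (simp add: F_def)
    then show ?thesis using that(3) by simp
  qed
  \<comment> \<open>Members of \<open>F\<close> share their \<open>C\<close>-part, so the
    \<open>A\<close>-part determines them.\<close>
  have "inj_on (\<lambda>x. restrict x A) F"
  proof (rule inj_onI)
    fix x y assume xy: "x \<in> F" "y \<in> F" and eq: "restrict x A = restrict y A"
    show "x = y"
    proof (rule messages_eqI[of _ "A \<union> C" t])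
      fix i assume "i \<in> A \<union> C"
      then show "x i = y i"
        using F_eq[OF xy] eq by (metis Un_iff restrict_apply')
    qed (use xy S in \<open>auto simp: F_def\<close>)
  qed
  then have "card SA = card F" unfolding SA_def by (rule card_image)
  moreover have "SA \<subseteq> messages A t"
    unfolding SA_def F_def using S restrict_messages[of _ "A \<union> C" t A] by auto
  moreover have "decodable D A SA"
    unfolding decodable_def
  proof (intro ballI impI)
    fix x y r assume "x \<in> SA" "y \<in> SA" and r: "r \<in> A"
      and eq: "\<forall>j\<in>out_nbrs D r \<inter> A. x j = y j"
    then obtain x' y' where x': "x' \<in> F" "x = restrict x' A" and y': "y' \<in> F" "y = restrict y' A"
      unfolding SA_def by auto
    have "x' r = y' r"
    proof (rule decodableD[OF dec])
      fix j assume j: "j \<in> out_nbrs D r" "j \<in> A \<union> C"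
      then show "x' j = y' j" using eq x' y' F_eq[OF x'(1) y'(1)] by (cases "j \<in> A") auto
    qed (use r x' y' in \<open>auto simp: F_def\<close>)
    then show "x r = y r" using x' y' r by simp
  qed
  ultimately show thesis using that SC_sub SC_dec by auto
qed

section \<open>Products and powers of independent sets\<close>

text \<open>Words are concatenated message by message. Fixed word lengths make the halves
  recoverable, so agreement of two concatenations is agreement of both halves.\<close>

lemma decodable_append:
  assumes S: "S \<subseteq> messages A s" "decodable D A S" and T: "T \<subseteq> messages A t" "decodable D A T"
  obtains R where "R \<subseteq> messages A (s + t)" "decodable D A R" "card R = card S * card T"
proof -
  define app where "app = (\<lambda>(x, y). \<lambda>i\<in>A. (x i @ y i :: bool list))"
  have split: "x i = x' i \<and> y i = y' i"
    if "x \<in> S" "x' \<in> S" "i \<in> A" "app (x, y) i = app (x', y') i" for x x' y y' i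
  proof -
    have "length (x i) = length (x' i)" using that S length_message by (metis subsetD)
    then show ?thesis using that(3,4) by (simp add: app_def)
  qed
  have "inj_on app (S \<times> T)"
  proof (rule inj_onI, clarify)
    fix x y x' y' assume xy: "x \<in> S" "x' \<in> S" "y \<in> T" "y' \<in> T" and eq: "app (x, y) = app (x', y')"
    have "x i = x' i \<and> y i = y' i" if "i \<in> A" for i
      using split[OF xy(1,2) that, of y y'] eq by simp
    then show "x = x' \<and> y = y'"
      using xy S T messages_eqI[of _ A] by (metis subsetD)
  qed
  then have "card (app ` (S \<times> T)) = card S * card T"
    by (simp add: card_image card_cartesian_product)
  moreover have "app ` (S \<times> T) \<subseteq> messages A (s + t)"
    using S T unfolding app_def messages_def bit_words_def by (fastforce simp: PiE_iff)
  moreover have "decodable D A (app ` (S \<times> T))"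
    unfolding decodable_def
  proof (intro ballI impI)
    fix u v r assume "u \<in> app ` (S \<times> T)" "v \<in> app ` (S \<times> T)" and r: "r \<in> A"
      and eq: "\<forall>j\<in>out_nbrs D r \<inter> A. u j = v j"
    then obtain x y x' y' where xy: "x \<in> S" "x' \<in> S" "y \<in> T" "y' \<in> T"
      "u = app (x, y)" "v = app (x', y')" by auto
    have j: "x j = x' j \<and> y j = y' j" if "j \<in> out_nbrs D r" "j \<in> A" for j
      using split[OF xy(1,2) that(2)] eq xy that by blast
    have "x r = x' r" by (rule decodableD[OF S(2) xy(1,2) r]) (use j in blast)
    moreover have "y r = y' r" by (rule decodableD[OF T(2) xy(3,4) r]) (use j in blast)
    ultimately show "u r = v r" using xy r by (simp add: app_def)
  qed
  ultimately show thesis using that by blast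
qed

lemma decodable_power:
  assumes "S \<subseteq> messages A t" "decodable D A S"
  shows "\<exists>R \<subseteq> messages A (k * t). decodable D A R \<and> card R = card S ^ k"
proof (induction k)
  case 0
  \<comment> \<open>For \<open>k = 0\<close> there is exactly one realization, by empty words,
    matching \<open>card S ^ 0 = 1\<close>.\<close>
  have "{\<lambda>i\<in>A. []} \<subseteq> messages A 0" by (auto simp: messages_def bit_words_def)
  moreover have "decodable D A {\<lambda>i\<in>A. []}" by (auto simp: decodable_def)
  ultimately show ?case by (intro exI[of _ "{\<lambda>i\<in>A. []}"]) simp
next
  case (Suc k)
  then obtain R where "R \<subseteq> messages A (k * t)" "decodable D A R" "card R = card S ^ k" by blast
  from decodable_append[OF assms this(1,2)] this(3) show ?case
    by (metis mult_Suc power_Suc)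
qed

section \<open>Greedy covering and colouring of the confusion graph\<close>

text \<open>By double counting, some \<open>T i\<close> contains at least the fraction
  \<open>q\<close> of the points still uncovered; choosing it shrinks the remainder to at most
  \<open>1 - q\<close> of its size.\<close>

lemma greedy_cover:
  fixes q :: real
  assumes fin: "finite X" "finite I" and ne: "I \<noteq> {}" and q: "q \<le> 1"
    and freq: "\<And>x. x \<in> X \<Longrightarrow> q * card I \<le> card {i \<in> I. x \<in> T i}"
  shows "\<exists>f. (\<forall>j. f j \<in> I) \<and> card (X - (\<Union>j<m. T (f j))) \<le> card X * (1 - q) ^ m"
proof (induction m)
  case 0
  show ?case using ne by auto
next
  case (Suc m)
  then obtain f :: "nat \<Rightarrow> 'b" where fI: "\<And>j. f j \<in> I" and f: "card (X - (\<Union>j<m. T (f j))) \<le> card X * (1 - q) ^ m" by blast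
  define U where "U = X - (\<Union>j<m. T (f j))"
  have finU: "finite U" using fin by (simp add: U_def)
  have "\<exists>i\<in>I. q * card U \<le> card {x \<in> U. x \<in> T i}"
  proof (rule ccontr)
    assume "\<not> ?thesis"
    then have "(\<Sum>i\<in>I. real (card {x \<in> U. x \<in> T i})) < (\<Sum>i\<in>I. q * card U)"
      using fin ne by (intro sum_strict_mono) auto
    also have "\<dots> = (\<Sum>x\<in>U. q * card I)" by simp
    also have "\<dots> \<le> (\<Sum>x\<in>U. real (card {i \<in> I. x \<in> T i}))"
      using freq by (intro sum_mono) (auto simp: U_def)
    also have "\<dots> = real (\<Sum>i\<in>I. card {x \<in> U. x \<in> T i})"
      using sum_multicount_gen[OF finU fin(2), of "\<lambda>x i. x \<in> T i" "\<lambda>i. card {x \<in> U. x \<in> T i}"]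
      by (simp flip: of_nat_sum)
    finally show False by simp
  qed
  then obtain i where i: "i \<in> I" "q * card U \<le> card {x \<in> U. x \<in> T i}" by blast
  have "(\<Union>j<Suc m. T ((f(m := i)) j)) = (\<Union>j<m. T (f j)) \<union> T i"
  proof -
    have "(\<Union>j<m. T ((f(m := i)) j)) = (\<Union>j<m. T (f j))" by (intro SUP_cong) auto
    then show ?thesis by (simp add: lessThan_Suc Un_commute)
  qed
  then have "X - (\<Union>j<Suc m. T ((f(m := i)) j)) = U - {x \<in> U. x \<in> T i}"
    by (auto simp: U_def)
  then have "real (card (X - (\<Union>j<Suc m. T ((f(m := i)) j)))) = real (card U) - real (card {x \<in> U. x \<in> T i})"
    using finU by (simp add: card_Diff_subset card_mono of_nat_diff)
  also have "\<dots> \<le> (1 - q) * card U" using i by (simp add: algebra_simps)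
  also have "\<dots> \<le> (1 - q) * (card X * (1 - q) ^ m)"
    using f q by (intro mult_left_mono) (auto simp: U_def)
  finally show ?case using fI i(1) by (intro exI[of _ "f(m := i)"]) (simp add: algebra_simps)
qed

text \<open>What is coloured is the confusion graph on \<open>A\<close>: two realizations are
  adjacent if some receiver in \<open>A\<close> has to tell them apart but cannot by its side
  information in \<open>A\<close>. With \<open>2 ^ p\<close> colours, a colour fits into
  \<open>p\<close> bits.\<close>

definition proper_colouring ::
  "'a pair_pre_digraph \<Rightarrow> 'a set \<Rightarrow> nat \<Rightarrow> nat \<Rightarrow> (('a \<Rightarrow> bool list) \<Rightarrow> nat) \<Rightarrow> bool" where
  "proper_colouring D A t m c \<longleftrightarrow>
     (\<forall>x\<in>messages A t. c x < m) \<and> (\<forall>j. decodable D A {x \<in> messages A t. c x = j})"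

lemma proper_colouring_mono: "proper_colouring D A t m c \<Longrightarrow> m \<le> n \<Longrightarrow> proper_colouring D A t n c"
  unfolding proper_colouring_def by (meson less_le_trans)

text \<open>An injective colouring works; it amounts to sending the messages uncoded.\<close>

lemma ex_proper_colouring:
  assumes "finite A"
  shows "\<exists>c. proper_colouring D A t (card (messages A t)) c"
proof -
  obtain c where c: "bij_betw c (messages A t) {0..<card (messages A t)}"
    using ex_bij_betw_finite_nat[OF finite_messages[OF assms]] by blast
  have "decodable D A {x \<in> messages A t. c x = j}" for j
    using c unfolding decodable_def bij_betw_def inj_on_def by blast
  moreover have "\<forall>x\<in>messages A t. c x < card (messages A t)"
    using bij_betwE[OF c] by auto
  ultimately show ?thesis unfolding proper_colouring_def by blast
qed

text \<open>On Booleans \<open>(\<noteq>)\<close> is addition modulo two, so adding a word twice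
  cancels; equal lengths keep \<open>map2\<close> from truncating.\<close>

lemma map2_neq_cancel:
  assumes "length (a :: bool list) = length b"
  shows "map2 (\<noteq>) (map2 (\<noteq>) a b) a = b" "map2 (\<noteq>) a (map2 (\<noteq>) a b) = b"
  using assms by (induction a b rule: list_induct2) auto

text \<open>The translates of \<open>S\<close> are independent, and each realization lies in at
  least the fraction \<open>q\<close> of them, where \<open>q\<close> is the density of
  \<open>S\<close>. So \<open>greedy_cover\<close> exhausts all realizations once \<open>m\<close>
  exceeds \<open>ln (card ?G) / q\<close>, and the index of a covering translate serves as
  colour.\<close>

lemma proper_colouring_of_decodable:
  assumes fin: "finite A" and S: "S \<subseteq> messages A t" "decodable D A S" "S \<noteq> {}"
    and m: "m > card (messages A t) / card S * ln (card (messages A t))"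
  shows "\<exists>c. proper_colouring D A t m c"
proof -
  let ?G = "messages A t"
  text \<open>\<open>shift g x\<close> is the sum of \<open>g\<close> and \<open>x\<close> over the field with two elements.\<close>
  define shift where "shift g x = (\<lambda>i\<in>A. map2 (\<noteq>) (g i) (x i))" for g x :: "'a \<Rightarrow> bool list"
  \<comment> \<open>Addition being self-inverse, \<open>T g\<close> is the translate of
    \<open>S\<close> by \<open>g\<close>.\<close>
  define T where "T g = {x \<in> ?G. shift g x \<in> S}" for g
  have finG: "finite ?G" and finS: "finite S"
    using fin S(1) finite_subset finite_messages by blast+
  have shift_in: "shift g x \<in> ?G" if "g \<in> ?G" "x \<in> ?G" for g x
    using that by (auto simp: shift_def messages_def bit_words_def PiE_iff)
  have cancel: "shift (shift x s) x = s" if "x \<in> ?G" "s \<in> ?G" for x s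
  proof (rule messages_eqI[OF _ that(2)])
    show "shift (shift x s) x \<in> ?G" using that shift_in by blast
    show "shift (shift x s) x i = s i" if "i \<in> A" for i
      using that map2_neq_cancel(1)[of "x i" "s i"] length_message[OF \<open>x \<in> ?G\<close> that]
        length_message[OF \<open>s \<in> ?G\<close> that] by (simp add: shift_def)
  qed
  have pos: "0 < card S" "card S \<le> card ?G"
    using S finS finG by (auto simp: card_gt_0_iff card_mono)
  define q where "q = real (card S) / real (card ?G)"
  have q: "0 < q" "q \<le> 1" using pos by (auto simp: q_def)
  have freq: "q * card ?G \<le> card {g \<in> ?G. x \<in> T g}" if x: "x \<in> ?G" for x
  proof -
    \<comment> \<open>The elements \<open>shift x s\<close> with \<open>s\<close> in
      \<open>S\<close> are distinct, and their translates contain \<open>x\<close>.\<close>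
    have "inj_on (shift x) S"
      by (rule inj_on_inverseI[where g = "\<lambda>g. shift g x"]) (use cancel x S in blast)
    moreover have "shift x ` S \<subseteq> {g \<in> ?G. x \<in> T g}"
    proof (rule image_subsetI)
      fix s assume s: "s \<in> S"
      then have "s \<in> ?G" using S by blast
      then show "shift x s \<in> {g \<in> ?G. x \<in> T g}"
        using shift_in[OF x] cancel[OF x] s x by (simp add: T_def)
    qed
    ultimately have "card S \<le> card {g \<in> ?G. x \<in> T g}"
      using finG by (intro card_inj_on_le) auto
    then show ?thesis using pos by (simp add: q_def)
  qed
  have "?G \<noteq> {}" using pos by auto
  then obtain f where fG: "\<And>j. f j \<in> ?G" and f: "card (?G - (\<Union>j<m. T (f j))) \<le> card ?G * (1 - q) ^ m"
    using greedy_cover[OF finG finG _ q(2) freq] by blast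
  \<comment> \<open>By \<open>1 - q \<le> exp (- q)\<close> and \<open>q * m > ln (card ?G)\<close>,
    less than one realization stays uncovered, hence none.\<close>
  have "(1 - q) ^ m \<le> exp (- q) ^ m"
    using q exp_ge_add_one_self[of "- q"] by (intro power_mono) auto
  also have "\<dots> = exp (- (q * m))" by (simp add: exp_of_nat_mult[symmetric] mult.commute)
  also have "\<dots> < exp (- ln (card ?G))"
    using m pos by (simp add: q_def field_simps)
  also have "\<dots> = 1 / card ?G" using pos by (simp add: exp_minus inverse_eq_divide)
  finally have "card ?G * (1 - q) ^ m < 1" using pos by (simp add: field_simps)
  with f have "card (?G - (\<Union>j<m. T (f j))) = 0" by linarith
  then have cover: "\<exists>j. j < m \<and> x \<in> T (f j)" if "x \<in> ?G" for x
    using that finG by auto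
  define c where "c x = (SOME j. j < m \<and> x \<in> T (f j))" for x
  have c: "c x < m" "x \<in> T (f (c x))" if "x \<in> ?G" for x
    using someI_ex[OF cover[OF that]] by (auto simp: c_def)
  have unshift: "map2 (\<noteq>) (g i) (shift g x i) = x i" if "g \<in> ?G" "x \<in> ?G" "i \<in> A" for g x i
    using that map2_neq_cancel(2)[of "g i" "x i"] length_message[of _ A t]
    by (simp add: shift_def)
  \<comment> \<open>Translation acts on each message separately, so it preserves and reflects
    agreement at every index.\<close>
  have "decodable D A (T g)" if g: "g \<in> ?G" for g
    unfolding decodable_def
  proof (intro ballI impI)
    fix x y r assume x: "x \<in> T g" and y: "y \<in> T g" and r: "r \<in> A"
      and eq: "\<forall>j\<in>out_nbrs D r \<inter> A. x j = y j"
    have "shift g x r = shift g y r"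
    proof (rule decodableD[OF S(2) _ _ r])
      show "shift g x \<in> S" "shift g y \<in> S" using x y by (simp_all add: T_def)
      show "shift g x j = shift g y j" if "j \<in> out_nbrs D r" "j \<in> A" for j
        using eq that by (simp add: shift_def)
    qed
    then show "x r = y r"
      using unshift[OF g _ r] x y unfolding T_def by (metis (mono_tags, lifting) mem_Collect_eq)
  qed
  then have "decodable D A (T (f j))" for j using fG by blast
  moreover have "{x \<in> ?G. c x = j} \<subseteq> T (f j)" for j using c(2) by blast
  ultimately have "decodable D A {x \<in> ?G. c x = j}" for j by (rule decodable_subset)
  then show ?thesis using c unfolding proper_colouring_def by blast
qed

text \<open>For the \<open>k\<close>-th power of \<open>S\<close> the colouring bound is the
  \<open>k\<close>-th power of the inverse density times a factor linear in \<open>k\<close>. In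
  bits this factor is a logarithmic overhead; the final \<open>+ 1\<close> pays for rounding up to a
  power of two.\<close>

lemma ex_short_colouring:
  assumes fin: "finite A" and S: "S \<subseteq> messages A t" "decodable D A S" "S \<noteq> {}"
  shows "\<exists>p c. proper_colouring D A (k * t) (2 ^ p) c \<and>
    p \<le> k * log 2 (card (messages A t) / card S)
        + log 2 (k * ln (card (messages A t)) + 1) + 1"
proof -
  define g where "g = real (card (messages A t))"
  define a where "a = real (card S)"
  have finG: "finite (messages A t)" and finS: "finite S"
    using fin S(1) finite_subset finite_messages by blast+
  have pos: "0 < a" "a \<le> g"
    using S finS finG by (auto simp: a_def g_def card_gt_0_iff card_mono)
  have g: "1 \<le> g" using fin by (simp add: g_def card_messages)
  obtain R where R: "R \<subseteq> messages A (k * t)" "decodable D A R" "card R = card S ^ k"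
    using decodable_power[OF S(1,2)] by blast
  have "R \<noteq> {}" using R(3) pos by (auto simp: a_def)
  have gk: "real (card (messages A (k * t))) = g ^ k"
    using fin by (simp add: g_def card_messages power_mult[symmetric] mult.assoc mult.left_commute
      mult.commute)
  define b where "b = (g / a) ^ k * (k * ln g)"
  \<comment> \<open>The added 1 makes \<open>b < m\<close> strict, as the covering argument
    demands.\<close>
  define m where "m = nat \<lfloor>b\<rfloor> + 1"
  have "0 \<le> b" using pos g by (simp add: b_def)
  have "b < m" unfolding m_def by linarith
  moreover have "card (messages A (k * t)) / card R * ln (card (messages A (k * t))) = b"
    using g by (simp add: gk R(3) b_def a_def power_divide ln_realpow)
  ultimately obtain c where c: "proper_colouring D A (k * t) m c"
    using proper_colouring_of_decodable[OF fin R(1,2) \<open>R \<noteq> {}\<close>, of m] by auto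
  define p where "p = nat \<lceil>log 2 m\<rceil>"
  have m1: "1 \<le> m" by (simp add: m_def)
  have "log 2 m \<le> p" unfolding p_def by linarith
  then have "m \<le> 2 powr p" using m1 by (simp add: log_le_iff)
  then have "m \<le> 2 ^ p" by (simp add: powr_realpow)
  then have "proper_colouring D A (k * t) (2 ^ p) c" by (rule proper_colouring_mono[OF c])
  moreover have "p \<le> k * log 2 (g / a) + log 2 (k * ln g + 1) + 1"
  proof -
    \<comment> \<open>A factor of at least 1 absorbs the \<open>+ 1\<close> of \<open>m\<close> into
      \<open>k * ln g + 1\<close>, which stays positive even if \<open>k * ln g\<close> is
      0.\<close>
    have "1 \<le> (g / a) ^ k" using pos by (intro one_le_power) simp
    then have "m \<le> (g / a) ^ k * (k * ln g + 1)"
      using \<open>0 \<le> b\<close> by (simp add: m_def b_def algebra_simps) linarith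
    moreover have "0 < (g / a) ^ k" "0 < k * ln g + 1"
      using pos g by (auto intro: add_nonneg_pos)
    ultimately have "log 2 m \<le> log 2 ((g / a) ^ k) + log 2 (k * ln g + 1)"
      using m1 by (subst log_mult_pos[symmetric]) (auto intro!: log_mono)
    also have "log 2 ((g / a) ^ k) = k * log 2 (g / a)"
      using pos by (intro log_nat_power) simp
    finally have "log 2 m \<le> k * log 2 (g / a) + log 2 (k * ln g + 1)" .
    moreover have "0 \<le> log 2 m" using m1 by simp
    then have "p \<le> log 2 m + 1" unfolding p_def by linarith
    ultimately show ?thesis by linarith
  qed
  ultimately show ?thesis unfolding g_def a_def by blast
qed

section \<open>Codes from colourings\<close>

lemma ex_bit_word_encoding:
  obtains e :: "nat \<Rightarrow> bool list" where "inj_on e {..<2 ^ p}" "e \<in> {..<2 ^ p} \<rightarrow> bit_words p"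
proof -
  obtain e where e: "bij_betw e {0..<card (bit_words p)} (bit_words p)"
    using ex_bij_betw_nat_finite[OF finite_bit_words] by blast
  show thesis
    by (rule that[of e]) (use e in \<open>auto simp: bij_betw_def lessThan_atLeast0\<close>)
qed

text \<open>Each sender transmits the colour of its share \<open>A1\<close> or \<open>A2\<close> of
  the realization. A receiver takes any realization of that colour consistent with its side
  information; as colour classes are independent, this gives its message correctly.\<close>

lemma two_sender_index_code_of_colourings:
  assumes cover: "A1 \<union> A2 = pverts D" and sub: "A1 \<subseteq> M1" "A2 \<subseteq> M2"
    and c1: "proper_colouring D A1 t (2 ^ p1) c1" and c2: "proper_colouring D A2 t (2 ^ p2) c2"
  shows "\<exists>enc1 enc2 dec. two_sender_index_code D M1 M2 t p1 p2 enc1 enc2 dec"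
proof -
  have recover: "\<exists>e g. (\<forall>x\<in>messages A t. e x \<in> bit_words p) \<and>
     (\<forall>r\<in>A. \<forall>x\<in>messages (pverts D) t. g r (e (restrict x A)) (restrict x (out_nbrs D r)) = x r)"
    if col: "proper_colouring D A t (2 ^ p) c" and A: "A \<subseteq> pverts D" for A p c
  proof -
    obtain w :: "nat \<Rightarrow> bool list" where w: "inj_on w {..<2 ^ p}" "w \<in> {..<2 ^ p} \<rightarrow> bit_words p"
      by (rule ex_bit_word_encoding)
    have lt: "c x < 2 ^ p" if "x \<in> messages A t" for x
      using col that unfolding proper_colouring_def by blast
    \<comment> \<open>\<open>Q r v s y\<close> marks \<open>y\<close> as compatible with codeword
      \<open>v\<close> and side information \<open>s\<close>. For \<open>r\<close> in
      \<open>A\<close> all such candidates agree at \<open>r\<close>, so \<open>g\<close> may read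
      off an arbitrary one.\<close>
    define Q where "Q r v s y \<longleftrightarrow> y \<in> messages A t \<and> w (c y) = v \<and> (\<forall>j\<in>out_nbrs D r \<inter> A. y j = s j)"
      for r v s y
    define g where "g r v s = (SOME y. Q r v s y) r" for r v s
    have "g r (w (c (restrict x A))) (restrict x (out_nbrs D r)) = x r"
      if r: "r \<in> A" and x: "x \<in> messages (pverts D) t" for r x
    proof -
      let ?Q = "Q r (w (c (restrict x A))) (restrict x (out_nbrs D r))"
      have x': "restrict x A \<in> messages A t" using restrict_messages[OF x A] .
      define y where "y = (SOME y. ?Q y)"
      have "?Q (restrict x A)" using x' by (simp add: Q_def)
      then have "?Q y" unfolding y_def by (rule someI[of ?Q])
      then have yG: "y \<in> messages A t" and "w (c y) = w (c (restrict x A))"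
        and eq: "\<And>j. j \<in> out_nbrs D r \<Longrightarrow> j \<in> A \<Longrightarrow> y j = x j"
        unfolding Q_def by auto
      then have "c y = c (restrict x A)"
        using w(1) lt[OF yG] lt[OF x'] by (auto dest: inj_onD)
      then have y_class: "y \<in> {z \<in> messages A t. c z = c (restrict x A)}" using yG by simp
      have x_class: "restrict x A \<in> {z \<in> messages A t. c z = c (restrict x A)}" using x' by simp
      have "decodable D A {z \<in> messages A t. c z = c (restrict x A)}"
        using col unfolding proper_colouring_def by blast
      then have "y r = restrict x A r"
        by (rule decodableD[OF _ y_class x_class r]) (simp add: eq)
      then show ?thesis using r by (simp add: g_def y_def)
    qed
    then show ?thesis
      using w(2) lt by (intro exI[of _ "\<lambda>x. w (c x)"] exI[of _ g]) auto
  qed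
  obtain e1 g1 where e1: "\<And>x. x \<in> messages A1 t \<Longrightarrow> e1 x \<in> bit_words p1"
    and g1: "\<And>r x. r \<in> A1 \<Longrightarrow> x \<in> messages (pverts D) t \<Longrightarrow>
      g1 r (e1 (restrict x A1)) (restrict x (out_nbrs D r)) = x r"
    using recover[OF c1] cover by blast
  obtain e2 g2 where e2: "\<And>x. x \<in> messages A2 t \<Longrightarrow> e2 x \<in> bit_words p2"
    and g2: "\<And>r x. r \<in> A2 \<Longrightarrow> x \<in> messages (pverts D) t \<Longrightarrow>
      g2 r (e2 (restrict x A2)) (restrict x (out_nbrs D r)) = x r"
    using recover[OF c2] cover by blast
  \<comment> \<open>The shares may overlap; a receiver in both listens to sender 1.\<close>
  have "two_sender_index_code D M1 M2 t p1 p2 (\<lambda>x. e1 (restrict x A1)) (\<lambda>x. e2 (restrict x A2))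
    (\<lambda>r v1 v2 s. if r \<in> A1 then g1 r v1 s else g2 r v2 s)"
    unfolding two_sender_index_code_def
    using e1 e2 g1 g2 cover sub
    by (auto simp: restrict_messages Int_absorb1)
  then show ?thesis by blast
qed

section \<open>Comparison of the two rates\<close>

text \<open>A single sender concatenates both codewords; the fixed length \<open>p1\<close> lets
  receivers cut them apart.\<close>

lemma index_code_of_two_sender:
  assumes code: "two_sender_index_code D M1 M2 t p1 p2 enc1 enc2 dec"
    and cover: "M1 \<union> M2 = pverts D"
  shows "\<exists>enc dec. index_code D t (p1 + p2) enc dec"
proof -
  define enc where "enc x = enc1 (restrict x M1) @ enc2 (restrict x M2)" for x
  define dec' where "dec' r w s = dec r (take p1 w) (drop p1 w) s" for r w s
  have enc1: "length (enc1 x) = p1" if "x \<in> messages M1 t" for x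
    using code that unfolding two_sender_index_code_def bit_words_def by auto
  have enc2: "length (enc2 x) = p2" if "x \<in> messages M2 t" for x
    using code that unfolding two_sender_index_code_def bit_words_def by auto
  have in1: "restrict x M1 \<in> messages M1 t" and in2: "restrict x M2 \<in> messages M2 t"
    if "x \<in> messages (pverts D) t" for x
    using that cover by (auto intro: restrict_messages)
  have "index_code D t (p1 + p2) enc dec'"
    unfolding index_code_def
  proof (intro conjI ballI Pi_I)
    fix x assume "x \<in> messages (pverts D) t"
    then show "enc x \<in> bit_words (p1 + p2)"
      using enc1[OF in1] enc2[OF in2] by (simp add: enc_def bit_words_def)
  next
    fix r x assume r: "r \<in> pverts D" and x: "x \<in> messages (pverts D) t"
    then show "dec' r (enc x) (restrict x (out_nbrs D r)) = x r"
      using code enc1[OF in1[OF x]] unfolding two_sender_index_code_def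
      by (simp add: enc_def dec'_def)
  qed
  then show ?thesis by blast
qed

text \<open>Both senders send all they know uncoded. This ensures that the \<open>LEAST\<close> in
  \<open>beta2_t\<close>, and after merging the one in \<open>beta_t\<close>, is attained.\<close>

lemma ex_two_sender_index_code:
  assumes fin: "finite (pverts D)" and cover: "M1 \<union> M2 = pverts D"
  shows "\<exists>p p1 p2 enc1 enc2 dec. p = p1 + p2 \<and> two_sender_index_code D M1 M2 t p1 p2 enc1 enc2 dec"
proof -
  have "\<exists>c. proper_colouring D A t (2 ^ (t * card A)) c" if "A \<subseteq> pverts D" for A
  proof -
    have "finite A" using that fin finite_subset by blast
    then show ?thesis using ex_proper_colouring[of A D t] by (simp add: card_messages)
  qed
  then obtain c1 c2 where "proper_colouring D M1 t (2 ^ (t * card M1)) c1"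
    "proper_colouring D M2 t (2 ^ (t * card M2)) c2"
    using cover by (metis Un_upper1 Un_upper2)
  from two_sender_index_code_of_colourings[OF cover subset_refl subset_refl this]
  show ?thesis by blast
qed

lemma beta_le_beta2:
  assumes fin: "finite (pverts D)" and cover: "M1 \<union> M2 = pverts D"
  shows "beta D \<le> beta2 D M1 M2"
  unfolding beta2_def
proof (rule cINF_greatest)
  fix t :: nat assume t: "t \<in> {1..}"
  let ?P = "\<lambda>p. \<exists>p1 p2 enc1 enc2 dec. p = p1 + p2 \<and> two_sender_index_code D M1 M2 t p1 p2 enc1 enc2 dec"
  have "?P (LEAST p. ?P p)" using ex_two_sender_index_code[OF fin cover, of t] by (rule LeastI_ex)
  then have "\<exists>enc dec. index_code D t (LEAST p. ?P p) enc dec"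
    using index_code_of_two_sender[OF _ cover] by metis
  then have "(LEAST p. \<exists>enc dec. index_code D t p enc dec) \<le> (LEAST p. ?P p)"
    by (rule Least_le)
  then have "beta_t t D \<le> beta2_t t D M1 M2"
    unfolding beta_t_def beta2_t_def by (intro divide_right_mono) auto
  moreover have "beta D \<le> beta_t t D"
    unfolding beta_def using t by (intro cINF_lower bdd_belowI2[of _ 0]) (auto simp: beta_t_def)
  ultimately show "beta D \<le> beta2_t t D M1 M2" by linarith
qed simp

lemma beta2_le_of_code:
  assumes "two_sender_index_code D M1 M2 t p1 p2 enc1 enc2 dec" "1 \<le> t"
  shows "beta2 D M1 M2 \<le> (p1 + p2) / t"
proof -
  have "beta2 D M1 M2 \<le> beta2_t t D M1 M2"
    unfolding beta2_def using assms(2)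
    by (intro cINF_lower bdd_belowI2[of _ 0]) (auto simp: beta2_t_def)
  also have "\<dots> \<le> real (p1 + p2) / t"
    unfolding beta2_t_def
  proof (intro divide_right_mono of_nat_mono Least_le)
    show "\<exists>q1 q2 enc1 enc2 dec. p1 + p2 = q1 + q2 \<and>
      two_sender_index_code D M1 M2 t q1 q2 enc1 enc2 dec"
      using assms(1) by blast
  qed simp
  finally show ?thesis by simp
qed

text \<open>By the assumption \<open>card\<close>, the inverse densities of \<open>S1\<close> and
  \<open>S2\<close> multiply to at most \<open>2 ^ p\<close>, so colourings for \<open>k * t\<close>
  bits take about \<open>k * p\<close> bits together. The overhead, logarithmic in \<open>k\<close>,
  vanishes in the rate as \<open>k\<close> grows.\<close>

lemma beta2_le_of_decodable:
  assumes fin: "finite (pverts D)" and cover: "A1 \<union> A2 = pverts D" "A1 \<inter> A2 = {}"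
    and sub: "A1 \<subseteq> M1" "A2 \<subseteq> M2" and t: "1 \<le> t"
    and S1: "S1 \<subseteq> messages A1 t" "decodable D A1 S1"
    and S2: "S2 \<subseteq> messages A2 t" "decodable D A2 S2"
    and card: "card (messages (pverts D) t) \<le> card S1 * card S2 * 2 ^ p"
  shows "beta2 D M1 M2 \<le> p / t"
proof -
  have finA: "finite A1" "finite A2" using fin cover(1) by (metis finite_Un)+
  define g1 where "g1 = real (card (messages A1 t))"
  define g2 where "g2 = real (card (messages A2 t))"
  define a1 where "a1 = real (card S1)"
  define a2 where "a2 = real (card S2)"
  have g: "1 \<le> g1" "1 \<le> g2" using finA by (auto simp: g1_def g2_def card_messages)
  have "card (messages (pverts D) t) = card (messages A1 t) * card (messages A2 t)"
    using finA cover(2) fin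
    by (simp add: card_messages cover(1)[symmetric] card_Un_disjoint power_add algebra_simps)
  then have "card (messages A1 t) * card (messages A2 t) \<le> card S1 * card S2 * 2 ^ p"
    using card by simp
  then have "real (card (messages A1 t) * card (messages A2 t)) \<le> real (card S1 * card S2 * 2 ^ p)"
    by (rule of_nat_mono)
  then have prod: "g1 * g2 \<le> a1 * a2 * 2 ^ p" by (simp add: g1_def g2_def a1_def a2_def)
  \<comment> \<open>Positivity rules out that \<open>S1\<close> or \<open>S2\<close> is empty, so
    the inverse densities make sense.\<close>
  have "0 < g1 * g2" using g by simp
  with prod have "a1 * a2 \<noteq> 0" by (intro notI) simp
  then have a: "0 < a1" "0 < a2" by (auto simp: a1_def a2_def)
  then have ne: "S1 \<noteq> {}" "S2 \<noteq> {}" by (auto simp: a1_def a2_def)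
  have "log 2 (g1 / a1) + log 2 (g2 / a2) = log 2 (g1 * g2 / (a1 * a2))"
    using a g by (simp add: log_mult_pos[symmetric])
  also have "\<dots> \<le> log 2 (2 ^ p)"
    using a g prod by (intro log_mono) (auto simp: field_simps)
  finally have logs: "log 2 (g1 / a1) + log 2 (g2 / a2) \<le> p" by simp
  \<comment> \<open>The excess over \<open>p / t\<close> of the rate for \<open>k * t\<close> bits;
    the 2 stems from rounding both colour counts.\<close>
  define err where "err k = (log 2 (k * ln g1 + 1) + log 2 (k * ln g2 + 1) + 2) / (k * t)" for k :: real
  have bound: "beta2 D M1 M2 \<le> p / t + err k" if k: "1 \<le> k" for k :: nat
  proof -
    obtain p1 c1 where c1: "proper_colouring D A1 (k * t) (2 ^ p1) c1"
      "p1 \<le> k * log 2 (g1 / a1) + log 2 (k * ln g1 + 1) + 1"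
      using ex_short_colouring[OF finA(1) S1 ne(1)] unfolding g1_def a1_def by blast
    obtain p2 c2 where c2: "proper_colouring D A2 (k * t) (2 ^ p2) c2"
      "p2 \<le> k * log 2 (g2 / a2) + log 2 (k * ln g2 + 1) + 1"
      using ex_short_colouring[OF finA(2) S2 ne(2)] unfolding g2_def a2_def by blast
    obtain enc1 enc2 dec where "two_sender_index_code D M1 M2 (k * t) p1 p2 enc1 enc2 dec"
      using two_sender_index_code_of_colourings[OF cover(1) sub c1(1) c2(1)] by blast
    then have "beta2 D M1 M2 \<le> (p1 + p2) / (k * t)"
      using beta2_le_of_code k t by fastforce
    also have "k * (log 2 (g1 / a1) + log 2 (g2 / a2)) \<le> k * real p"
      using logs by (intro mult_left_mono) auto
    then have "real p1 + real p2 \<le> k * real p + (log 2 (k * ln g1 + 1) + log 2 (k * ln g2 + 1) + 2)"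
      using c1(2) c2(2) by (simp add: algebra_simps)
    then have "(p1 + p2) / (k * t) \<le> (k * real p + (log 2 (k * ln g1 + 1) + log 2 (k * ln g2 + 1) + 2)) / (k * t)"
      by (intro divide_right_mono) auto
    also have "\<dots> = p / t + err k"
      using k t by (simp add: err_def add_divide_distrib)
    finally show ?thesis by simp
  qed
  \<comment> \<open>The case \<open>l = 0\<close> arises when a sender serves no messages, as then
    \<open>ln g1\<close> or \<open>ln g2\<close> is 0.\<close>
  have log_lim: "((\<lambda>k :: real. log 2 (k * l + 1) / k) \<longlongrightarrow> 0) at_top" if "0 \<le> l" for l :: real
  proof (cases "l = 0")
    case False
    with that have "0 < l" by simp
    then show ?thesis by real_asymp
  qed simp
  have "((\<lambda>k. (log 2 (k * ln g1 + 1) / k + log 2 (k * ln g2 + 1) / k + 2 / k) / t) \<longlongrightarrow> (0 + 0 + 0) / t) at_top"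
    using g t by (intro tendsto_intros log_lim) (auto, real_asymp)
  then have "(err \<longlongrightarrow> 0) at_top"
    by (simp add: err_def[abs_def] add_divide_distrib)
  then have "(\<lambda>k :: nat. p / t + err k) \<longlonglongrightarrow> p / t + 0"
    by (intro tendsto_intros filterlim_compose[OF _ filterlim_real_sequentially])
  then have "(\<lambda>k :: nat. p / t + err k) \<longlonglongrightarrow> p / t" by simp
  then show ?thesis
    by (rule LIMSEQ_le_const) (use bound in blast)
qed

text \<open>For each \<open>t\<close>, the shortest single-sender code yields an independent set;
  splitting it between \<open>M1\<close> and \<open>M2 - M1\<close> bounds \<open>beta2\<close> by
  \<open>beta_t t D\<close>.\<close>

lemma beta2_le_beta:
  assumes fin: "finite (pverts D)" and cover: "M1 \<union> M2 = pverts D"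
    and one_way: "(\<forall>u\<in>M1. \<forall>v\<in>M2 - M1. (u, v) \<notin> parcs D) \<or> (\<forall>u\<in>M2 - M1. \<forall>v\<in>M1. (u, v) \<notin> parcs D)"
  shows "beta2 D M1 M2 \<le> beta D"
  unfolding beta_def
proof (rule cINF_greatest)
  fix t :: nat assume t: "t \<in> {1..}"
  let ?p = "LEAST p. \<exists>enc dec. index_code D t p enc dec"
  let ?C = "M2 - M1"
  have V: "M1 \<union> ?C = pverts D" "?C \<union> M1 = pverts D" and finM: "finite M1" "finite ?C"
    using cover fin by (auto intro: finite_subset)
  have "\<exists>p enc dec. index_code D t p enc dec"
    using ex_two_sender_index_code[OF fin cover] index_code_of_two_sender[OF _ cover] by metis
  then have "\<exists>enc dec. index_code D t ?p enc dec" by (rule LeastI_ex)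
  then obtain enc dec where "index_code D t ?p enc dec" by blast
  then obtain S where S: "S \<subseteq> messages (pverts D) t" "decodable D (pverts D) S"
    and card_S: "card (messages (pverts D) t) \<le> card S * 2 ^ ?p"
    using fin by (rule index_code_decodable)
  obtain S1 S2 where S1: "S1 \<subseteq> messages M1 t" "decodable D M1 S1"
    and S2: "S2 \<subseteq> messages ?C t" "decodable D ?C S2" and card: "card S \<le> card S1 * card S2"
    using one_way
  proof (elim disjE)
    \<comment> \<open>Here the receivers in \<open>M1\<close> see nothing of the other side, so
      \<open>M1\<close> takes the role of \<open>C\<close> in
      \<open>decodable_split\<close>.\<close>
    assume no_arc: "\<forall>u\<in>M1. \<forall>v\<in>?C. (u, v) \<notin> parcs D"
    show thesis
      by (rule decodable_split[of S ?C M1 t D])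
        (use S V finM no_arc that in \<open>auto simp: mult.commute\<close>)
  next
    assume no_arc: "\<forall>u\<in>?C. \<forall>v\<in>M1. (u, v) \<notin> parcs D"
    show thesis
      by (rule decodable_split[of S M1 ?C t D]) (use S V finM no_arc that in auto)
  qed
  have "beta2 D M1 M2 \<le> ?p / t"
  proof (rule beta2_le_of_decodable[OF fin V(1) _ _ _ _ S1 S2])
    have "card S * 2 ^ ?p \<le> card S1 * card S2 * 2 ^ ?p" using card by (intro mult_right_mono) auto
    with card_S show "card (messages (pverts D) t) \<le> card S1 * card S2 * 2 ^ ?p"
      by (rule order_trans)
  qed (use t in auto)
  then show "beta2 D M1 M2 \<le> beta_t t D" by (simp add: beta_t_def)
qed simp

section \<open>Reduction to the absence of arcs in one direction\<close>

theorem corollary3: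
  fixes N :: nat and D :: "nat pair_pre_digraph" and M1 M2 :: "nat set"
    and B :: "(nat \<times> nat) set"
  assumes "pverts D = {1..N}"
    and "two_sender_problem D M1 M2"
    and "fully_participated D M1 M2"
    and "parcs (interaction_digraph D M1 M2) = {(1, 3), (3, 1)} \<union> B"
    and "B \<in> {{}, {(2, 3)}, {(3, 2)}, {(1, 2)}, {(2, 1)}, {(1, 2), (3, 2)}, {(2, 1), (2, 3)}}"
  shows "beta2 D M1 M2 = beta D"
proof -
  have fin: "finite (pverts D)" using assms(1) by simp
  have cover: "M1 \<union> M2 = pverts D" using assms(2) by (simp add: two_sender_problem_def)
  let ?F = "parcs (interaction_digraph D M1 M2)"
  \<comment> \<open>Used in contrapositive form: an arc missing in \<open>?F\<close> excludes all
    arcs of \<open>D\<close> between the two parts.\<close>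
  have arc: "(i, j) \<in> ?F"
    if "u \<in> msg_part M1 M2 i" "v \<in> msg_part M1 M2 j" "(u, v) \<in> parcs D"
      "i \<in> {1, 2, 3}" "j \<in> {1, 2, 3}" "i \<noteq> j" for i j u v
    using that by (auto simp: interaction_digraph_def sub_digraph_def)
  \<comment> \<open>\<open>M1\<close> consists of parts 1 and 3, so arcs between \<open>M1\<close>
    and \<open>M2 - M1\<close> appear in \<open>?F\<close> as arcs at vertex 2.\<close>
  have part: "\<exists>i. (i = 1 \<or> i = 3) \<and> u \<in> msg_part M1 M2 i" if "u \<in> M1" for u
  proof (cases "u \<in> M2")
    case True
    then show ?thesis using that by (intro exI[of _ 3]) (simp add: msg_part_def)
  next
    case False
    then show ?thesis using that by (intro exI[of _ 1]) (simp add: msg_part_def)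
  qed
  have part2: "u \<in> msg_part M1 M2 2" if "u \<in> M2 - M1" for u
    using that by (simp add: msg_part_def)
  \<comment> \<open>Each of the seven choices of \<open>B\<close> leaves vertex 2 without incoming
    or without outgoing arcs.\<close>
  have "(1, 2) \<notin> ?F \<and> (3, 2) \<notin> ?F \<or> (2, 1) \<notin> ?F \<and> (2, 3) \<notin> ?F"
    using assms(5) unfolding assms(4) by (elim insertE emptyE) simp_all
  then have "(\<forall>u\<in>M1. \<forall>v\<in>M2 - M1. (u, v) \<notin> parcs D) \<or> (\<forall>u\<in>M2 - M1. \<forall>v\<in>M1. (u, v) \<notin> parcs D)"
  proof (elim disjE)
    assume no: "(1, 2) \<notin> ?F \<and> (3, 2) \<notin> ?F"
    have "(u, v) \<notin> parcs D" if "u \<in> M1" "v \<in> M2 - M1" for u v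
    proof
      assume uv: "(u, v) \<in> parcs D"
      obtain i where i: "i = 1 \<or> i = 3" "u \<in> msg_part M1 M2 i" using part[OF \<open>u \<in> M1\<close>] by blast
      then have "(i, 2) \<in> ?F" by (intro arc[OF i(2) part2 uv] that) auto
      then show False using i(1) no by blast
    qed
    then show ?thesis by blast
  next
    assume no: "(2, 1) \<notin> ?F \<and> (2, 3) \<notin> ?F"
    have "(u, v) \<notin> parcs D" if "u \<in> M2 - M1" "v \<in> M1" for u v
    proof
      assume uv: "(u, v) \<in> parcs D"
      obtain i where i: "i = 1 \<or> i = 3" "v \<in> msg_part M1 M2 i" using part[OF \<open>v \<in> M1\<close>] by blast
      then have "(2, i) \<in> ?F" by (intro arc[OF part2 i(2) uv] that) auto
      then show False using i(1) no by blast
    qed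
    then show ?thesis by blast
  qed
  then show ?thesis
    using beta2_le_beta[OF fin cover] beta_le_beta2[OF fin cover] by (intro antisym)
qed

end
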